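(* The function $g(t)=e^{-1/t}$ is absolutely monotonic on $(-\infty,0)$.
   Context: An infinitely differentiable function $q(t)$ defined on an interval $I\subseteq\mathbb{R}$ is said to be absolutely monotonic on $I$ if $q^{(i)}(t)\ge 0$ holds on $I$ for all integers $i\ge 0$. *)

theory Defs
  imports "HOL-Analysis.Analysis"
begin

text \<open>
  The \<open>i\<close>-th derivative of \<open>q\<close> relative to \<open>I\<close>: derivatives at points of \<open>I\<close> are taken within \<open>I\<close>,
  hence one-sided at an endpoint belonging to \<open>I\<close>. Only the values at points of \<open>I\<close> are meaningful,
  and these depend only on the restriction of \<open>q\<close> to \<open>I\<close>.
\<close>

primrec nth_deriv_on :: "real set \<Rightarrow> nat \<Rightarrow> (real \<Rightarrow> real) \<Rightarrow> real \<Rightarrow> real" where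
  "nth_deriv_on I 0 q = q"
| "nth_deriv_on I (Suc i) q = (\<lambda>t. vector_derivative (nth_deriv_on I i q) (at t within I))"

definition infinitely_differentiable_on :: "(real \<Rightarrow> real) \<Rightarrow> real set \<Rightarrow> bool" where
  "infinitely_differentiable_on q I \<longleftrightarrow> (\<forall>i. nth_deriv_on I i q differentiable_on I)"

text \<open>
  The interval must have nonempty interior, since at an isolated point the derivative within \<open>I\<close>
  is not determined by \<open>q\<close>.
\<close>

definition absolutely_monotonic_on :: "(real \<Rightarrow> real) \<Rightarrow> real set \<Rightarrow> bool" where
  "absolutely_monotonic_on q I \<longleftrightarrow>
     is_interval I \<and> interior I \<noteq> {} \<and>
     infinitely_differentiable_on q I \<and>
     (\<forall>i. \<forall>t\<in>I. nth_deriv_on I i q t \<ge> 0)"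

end

theory Submission
  imports Defs "HOL-Computational_Algebra.Polynomial"
begin

text \<open>
  Substitute \<open>u = - 1 / t\<close>, which is positive for \<open>t < 0\<close> and satisfies \<open>du/dt = u\<^sup>2\<close>. For every
  polynomial \<open>p\<close>, the \<open>t\<close>-derivative of \<open>p(u) e\<^sup>u\<close> is therefore \<open>u\<^sup>2 (p(u) + p'(u)) e\<^sup>u\<close>, again a
  polynomial in \<open>u\<close> times \<open>e\<^sup>u\<close>. So the \<open>n\<close>-th derivative of \<open>e\<^sup>u\<close> is \<open>P\<^sub>n(u) e\<^sup>u\<close> with \<open>P\<^sub>0 = 1\<close> and
  \<open>P\<^sub>n\<^sub>+\<^sub>1 = x\<^sup>2 (P\<^sub>n + P\<^sub>n')\<close>. This recursion preserves nonnegativity of the coefficients, and a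
  polynomial with nonnegative coefficients is nonnegative at \<open>u > 0\<close>.
\<close>

text \<open>The polynomials \<open>P\<^sub>n\<close> such that the \<open>n\<close>-th derivative of \<open>exp (- 1 / t)\<close> is
  \<open>P\<^sub>n (- 1 / t) * exp (- 1 / t)\<close>.\<close>

primrec exp_recip_poly :: "nat \<Rightarrow> real poly" where
  "exp_recip_poly 0 = 1"
| "exp_recip_poly (Suc n) = monom 1 2 * (exp_recip_poly n + pderiv (exp_recip_poly n))"

lemma coeff_exp_recip_poly_nonneg: "coeff (exp_recip_poly n) k \<ge> 0"
proof (induction n arbitrary: k)
  case 0
  show ?case by (simp add: coeff_1)
next
  case (Suc n)
  then show ?case by (simp add: coeff_monom_mult coeff_pderiv)
qed

lemma poly_nonneg_if_coeffs_nonneg: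
  fixes p :: "'a::linordered_idom poly"
  assumes "\<And>k. coeff p k \<ge> 0" and "x \<ge> 0"
  shows "poly p x \<ge> 0"
  using assms by (simp add: poly_altdef sum_nonneg)

lemma has_real_derivative_poly_exp_recip:
  fixes p :: "real poly"
  assumes "t \<noteq> 0"
  shows "((\<lambda>t. poly p (- (1 / t)) * exp (- (1 / t))) has_real_derivative
           poly (monom 1 2 * (p + pderiv p)) (- (1 / t)) * exp (- (1 / t))) (at t within S)"
proof -
  have u: "((\<lambda>t. - (1 / t)) has_real_derivative (- (1 / t))\<^sup>2) (at t within S)"
    using assms by (auto intro!: derivative_eq_intros simp: power2_eq_square)
  have "((\<lambda>t. poly p (- (1 / t))) has_real_derivative
          poly (pderiv p) (- (1 / t)) * (- (1 / t))\<^sup>2) (at t within S)"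
    by (rule DERIV_chain2[OF poly_DERIV u])
  moreover have "((\<lambda>t. exp (- (1 / t))) has_real_derivative
          exp (- (1 / t)) * (- (1 / t))\<^sup>2) (at t within S)"
    by (rule DERIV_chain2[OF DERIV_exp u])
  ultimately show ?thesis
    by (rule DERIV_mult[THEN DERIV_cong]) (simp add: poly_monom algebra_simps)
qed

lemma nth_deriv_on_exp_recip:
  assumes "t < 0"
  shows "nth_deriv_on {..<0} n (\<lambda>t. exp (- (1 / t))) t
         = poly (exp_recip_poly n) (- (1 / t)) * exp (- (1 / t))"
  using assms
proof (induction n arbitrary: t)
  case 0
  show ?case by simp
next
  case (Suc n)
  have "(nth_deriv_on {..<0} n (\<lambda>t. exp (- (1 / t))) has_real_derivative
          poly (exp_recip_poly (Suc n)) (- (1 / t)) * exp (- (1 / t))) (at t within {..<0})"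
    unfolding exp_recip_poly.simps
    by (rule has_field_derivative_transform_within
        [OF has_real_derivative_poly_exp_recip zero_less_one])
      (use Suc in auto)
  moreover have "at t within {..<0} \<noteq> bot"
    using Suc.prems by (simp add: at_within_open[of t "{..<0}"])
  ultimately show ?case
    by (simp add: has_real_derivative_iff_has_vector_derivative vector_derivative_within)
qed

theorem theorem8:
  "absolutely_monotonic_on (\<lambda>t::real. exp (- (1 / t))) {..<0}"
  unfolding absolutely_monotonic_on_def infinitely_differentiable_on_def
proof (intro conjI allI ballI)
  show "is_interval {..<0::real}"
    by (rule is_interval_io)
  show "interior {..<0::real} \<noteq> {}"
    by (simp add: interior_open)
next
  fix n
  show "nth_deriv_on {..<0} n (\<lambda>t. exp (- (1 / t))) differentiable_on {..<0}"
    unfolding differentiable_on_def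
  proof
    fix t :: real
    assume t: "t \<in> {..<0}"
    then have "(\<lambda>t. poly (exp_recip_poly n) (- (1 / t)) * exp (- (1 / t)))
        differentiable (at t within {..<0})"
      using has_real_derivative_poly_exp_recip[of t] real_differentiable_def by blast
    then show "nth_deriv_on {..<0} n (\<lambda>t. exp (- (1 / t))) differentiable (at t within {..<0})"
      by (rule differentiable_transform_within[OF _ zero_less_one t])
        (simp add: nth_deriv_on_exp_recip)
  qed
next
  fix n and t :: real
  assume "t \<in> {..<0}"
  then show "nth_deriv_on {..<0} n (\<lambda>t. exp (- (1 / t))) t \<ge> 0"
    by (simp add: nth_deriv_on_exp_recip poly_nonneg_if_coeffs_nonneg
        coeff_exp_recip_poly_nonneg)
qed

end
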